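(* For every integer $n\geq 3$, the matrix $\mathbb{j}_{n}=\mathrm{circ}(j_{0},j_{1},\ldots ,j_{n-1})$ is invertible.
   Context: The Jacobsthal-Lucas numbers are defined by $j_0=2$, $j_1=1$, $j_{k}=j_{k-1}+2j_{k-2}$ for $k\ge 2$. For numbers $c_0,\dots,c_{n-1}$, $\mathrm{circ}(c_0,c_1,\ldots,c_{n-1})$ denotes the $n\times n$ circulant matrix whose first row is $(c_0,c_1,\ldots,c_{n-1})$ and each of whose later rows is the cyclic right shift by one of the row above; i.e. the $(i,j)$ entry ($1\le i,j\le n$) is $c_{(j-i)\bmod n}$. *)

theory Defs
  imports Complex_Main "Jordan_Normal_Form.Matrix"
begin

fun jacobsthal_lucas :: "nat \<Rightarrow> int" where
  "jacobsthal_lucas 0 = 2"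
| "jacobsthal_lucas (Suc 0) = 1"
| "jacobsthal_lucas (Suc (Suc k)) = jacobsthal_lucas (Suc k) + 2 * jacobsthal_lucas k"

(* Indices are 0-based, which leaves j - i unchanged. The subtraction is done in int,
   so that the residue is the representative in {0..<n}. *)
definition circ :: "nat \<Rightarrow> (nat \<Rightarrow> 'a) \<Rightarrow> 'a mat" where
  "circ n c = mat n n (\<lambda>(i, j). c (nat ((int j - int i) mod int n)))"

end

theory Submission
  imports Defs "Jordan_Normal_Form.Determinant"
begin

text \<open>
  A kernel vector of the circulant matrix extends to an \<open>n\<close>-periodic sequence \<open>u\<close> with
  \<open>\<Sum>k<n. j\<^sub>k u\<^sub>i\<^sub>+\<^sub>k = 0\<close> for all \<open>i\<close>. Since \<open>j\<^sub>k = 2\<^sup>k + (-1)\<^sup>k\<close>, the sum splits into two geometric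
  parts \<open>A\<^sub>i + B\<^sub>i\<close>, and periodicity gives each part a first-order recurrence in \<open>i\<close>.
  Eliminating \<open>A\<close> and \<open>B\<close> leaves \<open>u\<^sub>i\<^sub>+\<^sub>1 = -q u\<^sub>i\<close>, where \<open>q = 1\<close> for even \<open>n\<close> and
  \<open>q = (2\<^sup>n - 3) / (2\<^sup>n + 3)\<close> for odd \<open>n\<close>. For odd \<open>n\<close> periodicity forces \<open>u = 0\<close>, as \<open>0 < q < 1\<close>;
  for even \<open>n\<close> the sum equals \<open>(n - (2\<^sup>n - 1) / 3) u\<^sub>i\<close>, whose coefficient is nonzero for \<open>n \<ge> 4\<close>.
\<close>

lemma jacobsthal_lucas_closed_form: "jacobsthal_lucas k = 2 ^ k + (- 1) ^ k"
  by (induction k rule: jacobsthal_lucas.induct) auto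

text \<open>Multiplying by \<open>x\<close> realigns the powers: the term \<open>u i\<close> drops
  out at the front and, by periodicity, returns at the end with factor \<open>x ^ n\<close>.\<close>

lemma periodic_geometric_sum_shift:
  fixes u :: "nat \<Rightarrow> 'a::comm_ring_1"
  assumes "u (i + n) = u i"
  shows "x * (\<Sum>k<n. x ^ k * u (Suc i + k)) = (\<Sum>k<n. x ^ k * u (i + k)) + (x ^ n - 1) * u i"
proof -
  have "x * (\<Sum>k<n. x ^ k * u (Suc i + k)) = (\<Sum>k<n. x ^ Suc k * u (i + Suc k))"
    by (simp add: sum_distrib_left mult.assoc)
  also have "u i + \<dots> = (\<Sum>k<Suc n. x ^ k * u (i + k))"
    by (simp only: sum.lessThan_Suc_shift) simp
  finally show ?thesis
    using assms by (simp add: algebra_simps)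
qed

lemma jacobsthal_lucas_periodic_eq_0:
  fixes u :: "nat \<Rightarrow> real"
  assumes n: "n \<ge> 3"
    and per: "\<And>i. u (i + n) = u i"
    and ker: "\<And>i. (\<Sum>k<n. real_of_int (jacobsthal_lucas k) * u (i + k)) = 0"
  shows "u i = 0"
proof -
  define A where "A i = (\<Sum>k<n. 2 ^ k * u (i + k))" for i
  define B where "B i = (\<Sum>k<n. (- 1) ^ k * u (i + k))" for i
  have AB: "A i + B i = 0" for i
    using ker[of i]
    by (simp add: A_def B_def jacobsthal_lucas_closed_form distrib_right sum.distrib)
  have A_Suc: "2 * A (Suc i) = A i + (2 ^ n - 1) * u i" for i
    unfolding A_def by (rule periodic_geometric_sum_shift[where u = u, OF per])
  have B_Suc: "- 1 * B (Suc i) = B i + ((- 1) ^ n - 1) * u i" for i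
    unfolding B_def by (rule periodic_geometric_sum_shift[where u = u, OF per])
  have pow: "(2::real) ^ n \<ge> 8"
    using power_increasing[OF n, of "2::real"] by simp
  show ?thesis
  proof (cases "even n")
    case True
    \<comment> \<open>For even \<open>n\<close> the \<open>u i\<close> term of \<open>B_Suc\<close>
      vanishes, so \<open>B\<close>, and hence \<open>A = - B\<close>, alternates in sign.\<close>
    have A_neg: "A (Suc i) = - A i" for i
      using B_Suc[of i] AB[of i] AB[of "Suc i"] True by simp
    have A_u: "3 * A i = (1 - 2 ^ n) * u i" for i
      using A_Suc[of i] A_neg[of i] by (simp add: algebra_simps)
    have "(1 - 2 ^ n) * u (Suc i) = (1 - 2 ^ n) * - u i" for i
      using A_u[of i] A_u[of "Suc i"] A_neg[of i] by (simp add: algebra_simps)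
    moreover have "(1::real) - 2 ^ n \<noteq> 0"
      using pow by linarith
    ultimately have u_Suc: "u (Suc i) = - u i" for i
      using mult_cancel_left by blast
    have u_add: "u (i + k) = (- 1) ^ k * u i" for k
      by (induction k) (simp_all add: u_Suc)
    have "(- 1) ^ k * u (i + k) = u i" for k
      unfolding u_add mult.assoc[symmetric] power_mult_distrib[symmetric] by simp
    then have "B i = real n * u i"
      by (simp add: B_def)
    then have eq: "(2 ^ n - 1 - 3 * real n) * u i = 0"
      using A_u[of i] AB[of i] by (simp add: algebra_simps)
    \<comment> \<open>Parity excludes \<open>n = 3\<close>, where the next inequality fails.\<close>
    have "n \<ge> 4"
      using n True by (cases "n = 3") auto
    then have "3 * real n + 1 < 2 ^ n"
      by (induction n rule: dec_induct) auto
    with eq show ?thesis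
      by simp
  next
    case False
    \<comment> \<open>With \<open>B = - A\<close>, \<open>B_Suc\<close> reads
      \<open>A (Suc i) = - A i - 2 * u i\<close>; substitute this into \<open>A_Suc\<close>.\<close>
    have A_u: "3 * A i = - (2 ^ n + 3) * u i" for i
      using A_Suc[of i] B_Suc[of i] AB[of i] AB[of "Suc i"] False by (simp add: algebra_simps)
    have "(2 ^ n + 3) * u (Suc i) = - (2 ^ n - 3) * u i" for i
      using A_u[of i] A_u[of "Suc i"] A_Suc[of i] by (simp add: algebra_simps)
    define q :: real where "q = (2 ^ n - 3) / (2 ^ n + 3)"
    have q: "0 < q" "q < 1"
      using pow by (auto simp: q_def)
    have u_Suc: "u (Suc i) = - q * u i" for i
      using \<open>(2 ^ n + 3) * u (Suc i) = - (2 ^ n - 3) * u i\<close> pow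
      by (simp add: q_def field_simps)
    have u_add: "u (i + k) = (- q) ^ k * u i" for k
      by (induction k) (simp_all add: u_Suc)
    have "(1 + q ^ n) * u i = 0"
      using u_add[of n] per[of i] False by (simp add: algebra_simps)
    moreover have "1 + q ^ n > 0"
      using q by (simp add: add_pos_pos)
    ultimately show ?thesis
      by simp
  qed
qed

text \<open>Substituting \<open>k = (j - i) mod n\<close> moves the cyclic shift from the
  coefficients to the vector.\<close>

lemma circ_mult_vec:
  fixes c :: "nat \<Rightarrow> 'a::semiring_0"
  assumes "i < n" "v \<in> carrier_vec n"
  shows "(circ n c *\<^sub>v v) $ i = (\<Sum>k<n. c k * v $ ((i + k) mod n))"
proof -
  have "(circ n c *\<^sub>v v) $ i = (\<Sum>j<n. c (nat ((int j - int i) mod int n)) * v $ j)"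
    using assms by (auto simp: circ_def scalar_prod_def lessThan_atLeast0 intro!: sum.cong)
  also have "\<dots> = (\<Sum>k<n. c k * v $ ((i + k) mod n))"
  proof (rule sum.reindex_bij_witness[where j = "\<lambda>j. nat ((int j - int i) mod int n)"
        and i = "\<lambda>k. (i + k) mod n"])
    fix j assume "j \<in> {..<n}"
    then have "int ((i + nat ((int j - int i) mod int n)) mod n) = int j"
      by (simp add: zmod_int mod_add_right_eq)
    then show "(i + nat ((int j - int i) mod int n)) mod n = j"
      by (simp only: of_nat_eq_iff)
    then show "c (nat ((int j - int i) mod int n)) * v $ ((i + nat ((int j - int i) mod int n)) mod n)
        = c (nat ((int j - int i) mod int n)) * v $ j"
      by simp
  next
    fix k assume "k \<in> {..<n}"
    then show "nat ((int ((i + k) mod n) - int i) mod int n) = k"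
      by (simp add: zmod_int mod_diff_left_eq)
  qed (auto simp: nat_less_iff)
  finally show ?thesis .
qed

lemma invertible_mat_if_det_nonzero:
  fixes A :: "'a::field mat"
  assumes "A \<in> carrier_mat n n" "det A \<noteq> 0"
  shows "invertible_mat A"
proof -
  \<comment> \<open>\<open>()\<close> merely fills the record extension of the matrix ring.\<close>
  obtain B where "B \<in> carrier_mat n n" "B * A = 1\<^sub>m n" "A * B = 1\<^sub>m n"
    using det_non_zero_imp_unit[OF assms, of "()"] by (auto simp: Units_def ring_mat_simps)
  with assms(1) have "inverts_mat A B" "inverts_mat B A" "square_mat A"
    by (auto simp: inverts_mat_def)
  then show ?thesis
    unfolding invertible_mat_def by blast
qed

theorem theorem7:
  fixes n :: nat
  assumes "n \<ge> 3"
  shows "invertible_mat (circ n (\<lambda>k. real_of_int (jacobsthal_lucas k)))"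
proof (rule invertible_mat_if_det_nonzero)
  let ?C = "circ n (\<lambda>k. real_of_int (jacobsthal_lucas k))"
  show C: "?C \<in> carrier_mat n n"
    by (simp add: circ_def)
  show "det ?C \<noteq> 0"
  proof
    assume "det ?C = 0"
    then obtain v where v: "v \<in> carrier_vec n" "v \<noteq> 0\<^sub>v n" "?C *\<^sub>v v = 0\<^sub>v n"
      using det_0_iff_vec_prod_zero_field[OF C] by blast
    have "v $ (i mod n) = 0" for i
    proof (rule jacobsthal_lucas_periodic_eq_0[OF assms, where u = "\<lambda>i. v $ (i mod n)"])
      fix i
      have "i mod n < n"
        using assms by simp
      from circ_mult_vec[OF this v(1), of "\<lambda>k. real_of_int (jacobsthal_lucas k)"] v(3) this
      show "(\<Sum>k<n. real_of_int (jacobsthal_lucas k) * v $ ((i + k) mod n)) = 0"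
        by (simp add: mod_add_left_eq)
    qed simp
    then have "v $ i = 0" if "i < n" for i
      using that by (metis mod_less)
    then have "v = 0\<^sub>v n"
      using v(1) by auto
    with v(2) show False
      by contradiction
  qed
qed

end
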